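(* Let $a,b,c,f\in\mathbb R$ with $a,b\ne0$, $f>0$ and $f^2=a^2-b^2$, and let $S\subset\mathbb R^3$ be the Dupin cyclide of Type II in canonical form, i.e. the zero set of $$(x^2+y^2+z^2+a^2-f^2-c^2)^2-4(ax-cf)^2-4y^2(a^2-f^2),$$ with spine curves and radius functions $$\mathbf c_1(t)=\Big(\tfrac{1-t^2}{1+t^2}a,\tfrac{2t}{1+t^2}b,0\Big),\quad r_1(t)=c-f\tfrac{1-t^2}{1+t^2},\qquad \mathbf c_2(t)=\Big(\tfrac{1+t^2}{1-t^2}f,0,\tfrac{2t}{1-t^2}b\Big),\quad r_2(t)=c-a\tfrac{1+t^2}{1-t^2}.$$ For an isometry $\mathbf f$ of $\mathbb R^3$ and Möbius transformations $\varphi_1,\varphi_2$, the conditions (A1) $\mathbf f\circ\mathbf c_1=\mathbf c_1\circ\varphi_1$ and $\mathbf f\circ\mathbf c_2=\mathbf c_2\circ\varphi_2$, and (A2) $r_1^2=(r_1\circ\varphi_1)^2$ and $r_2^2=(r_2\circ\varphi_2)^2$ are satisfied if and only if one of the following holds: - $c\ne0$ and $(\varphi_1,\varphi_2)$, $\mathbf f$ are given by one of the cases (a)–(d) below; these isometries form a symmetry group of $S$ isomorphic to $\mathbb Z_2^2$ (the Klein four group); - $c=0$ and $(\varphi_1,\varphi_2)$, $\mathbf f$ are given by one of the cases (a)–(h) below; these isometries form a symmetry group of $S$ isomorphic to $\mathbb Z_2^3$ (the elementary abelian group of order 8). The cases, listing $(\varphi_1(t),\varphi_2(t))$ and $\mathbf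 f(x,y,z)$, are: (a) $(t,t)$, $(x,y,z)$; (b) $(t,-t)$, $(x,y,-z)$; (c) $(-t,t)$, $(x,-y,z)$; (d) $(-t,-t)$, $(x,-y,-z)$; (e) $(1/t,-1/t)$, $(-x,y,z)$; (f) $(1/t,1/t)$, $(-x,y,-z)$; (g) $(-1/t,-1/t)$, $(-x,-y,z)$; (h) $(-1/t,1/t)$, $(-x,-y,-z)$.
   Context: A Möbius transformation is a real rational function $\varphi(t)=\frac{\alpha t+\beta}{\gamma t+\delta}$ with real coefficients and $\alpha\delta-\beta\gamma\ne0$. An isometry of $\mathbb R^3$ is a map $\mathbf x\mapsto\mathbf Q\mathbf x+\mathbf b$ with $\mathbf Q$ orthogonal and $\mathbf b\in\mathbb R^3$; it is a symmetry of $S$ if it maps $S$ onto $S$. Identities between compositions are identities of rational functions. A pair $(\mathbf c_i,r_i)$ represents $S$ as the envelope of the spheres with center $\mathbf c_i(t)$ (spine curve) and radius $r_i(t)$ (radius function). The scalar $f$ is a parameter of the cyclide, distinct from the isometry $\mathbf f$. *)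

theory Defs
  imports
    "HOL-Analysis.Analysis"
    "HOL-Computational_Algebra.Computational_Algebra"
    "HOL-Computational_Algebra.Field_as_Ring"
    "HOL-Algebra.Elementary_Groups"
begin

text \<open>Real rational functions are the elements of the field \<open>\<real>(t)\<close>, so that equations between them
  are identities of rational functions.\<close>

type_synonym ratfun = "real poly fract"

definition rf_const :: "real \<Rightarrow> ratfun" where
  "rf_const x = to_fract [:x:]"

definition rf_t :: ratfun where
  "rf_t = to_fract [:0, 1:]"

text \<open>Composition \<open>r \<circ> s\<close>: substitute \<open>s\<close> into the numerator and the denominator of the reduced
  fraction \<open>r = p / q\<close>. If \<open>s\<close> is not constant (e.g. a Moebius transformation), then \<open>q(s) \<noteq> 0\<close>
  and the value does not depend on the representation of \<open>r\<close>; for constant \<open>s\<close> at a pole of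
  \<open>r\<close> the value is the convention \<open>x / 0 = 0\<close>.\<close>

definition rf_comp :: "ratfun \<Rightarrow> ratfun \<Rightarrow> ratfun" where
  "rf_comp r s = (let (p, q) = quot_of_fract r in
     poly (map_poly rf_const p) s / poly (map_poly rf_const q) s)"

definition curve_comp :: "ratfun ^ 3 \<Rightarrow> ratfun \<Rightarrow> ratfun ^ 3" where
  "curve_comp C s = (\<chi> i. rf_comp (C $ i) s)"

definition moebius_transformation :: "ratfun \<Rightarrow> bool" where
  "moebius_transformation \<phi> \<longleftrightarrow> (\<exists>\<alpha> \<beta> \<gamma> \<delta>. \<alpha> * \<delta> - \<beta> * \<gamma> \<noteq> 0 \<and>
     \<phi> = (rf_const \<alpha> * rf_t + rf_const \<beta>) / (rf_const \<gamma> * rf_t + rf_const \<delta>))"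

definition affine_map :: "real ^ 3 ^ 3 \<Rightarrow> real ^ 3 \<Rightarrow> real ^ 3 \<Rightarrow> real ^ 3" where
  "affine_map Q w = (\<lambda>x. Q *v x + w)"

text \<open>The composition of the affine map \<open>x \<mapsto> Q x + w\<close> with a rational curve.\<close>

definition affine_curve :: "real ^ 3 ^ 3 \<Rightarrow> real ^ 3 \<Rightarrow> ratfun ^ 3 \<Rightarrow> ratfun ^ 3" where
  "affine_curve Q w C = map_matrix rf_const Q *v C + (\<chi> i. rf_const (w $ i))"

definition isometry3 :: "(real ^ 3 \<Rightarrow> real ^ 3) \<Rightarrow> bool" where
  "isometry3 F \<longleftrightarrow> (\<exists>Q w. orthogonal_matrix Q \<and> F = affine_map Q w)"

definition symmetry_group :: "(real ^ 3) set \<Rightarrow> (real ^ 3 \<Rightarrow> real ^ 3) monoid" where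
  "symmetry_group S = \<lparr>carrier = {F. isometry3 F \<and> F ` S = S}, mult = (\<circ>), one = id\<rparr>"

definition dupin_cyclide_II :: "real \<Rightarrow> real \<Rightarrow> real \<Rightarrow> (real ^ 3) set" where
  "dupin_cyclide_II a c f = {p. let x = p $ 1; y = p $ 2; z = p $ 3 in
     (x\<^sup>2 + y\<^sup>2 + z\<^sup>2 + a\<^sup>2 - f\<^sup>2 - c\<^sup>2)\<^sup>2 - 4 * (a * x - c * f)\<^sup>2 - 4 * y\<^sup>2 * (a\<^sup>2 - f\<^sup>2) = 0}"

definition spine1 :: "real \<Rightarrow> real \<Rightarrow> ratfun ^ 3" where
  "spine1 a b = vector
     [(1 - rf_t\<^sup>2) / (1 + rf_t\<^sup>2) * rf_const a, 2 * rf_t / (1 + rf_t\<^sup>2) * rf_const b, 0]"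

definition radius1 :: "real \<Rightarrow> real \<Rightarrow> ratfun" where
  "radius1 c f = rf_const c - rf_const f * ((1 - rf_t\<^sup>2) / (1 + rf_t\<^sup>2))"

definition spine2 :: "real \<Rightarrow> real \<Rightarrow> ratfun ^ 3" where
  "spine2 b f = vector
     [(1 + rf_t\<^sup>2) / (1 - rf_t\<^sup>2) * rf_const f, 0, 2 * rf_t / (1 - rf_t\<^sup>2) * rf_const b]"

definition radius2 :: "real \<Rightarrow> real \<Rightarrow> ratfun" where
  "radius2 a c = rf_const c - rf_const a * ((1 + rf_t\<^sup>2) / (1 - rf_t\<^sup>2))"

definition condition_A1 :: "real \<Rightarrow> real \<Rightarrow> real \<Rightarrow> real ^ 3 ^ 3 \<Rightarrow> real ^ 3 \<Rightarrow> ratfun \<Rightarrow> ratfun \<Rightarrow> bool" where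
  "condition_A1 a b f Q w \<phi>1 \<phi>2 \<longleftrightarrow>
     affine_curve Q w (spine1 a b) = curve_comp (spine1 a b) \<phi>1 \<and>
     affine_curve Q w (spine2 b f) = curve_comp (spine2 b f) \<phi>2"

definition condition_A2 :: "real \<Rightarrow> real \<Rightarrow> real \<Rightarrow> ratfun \<Rightarrow> ratfun \<Rightarrow> bool" where
  "condition_A2 a c f \<phi>1 \<phi>2 \<longleftrightarrow>
     (radius1 c f)\<^sup>2 = (rf_comp (radius1 c f) \<phi>1)\<^sup>2 \<and>
     (radius2 a c)\<^sup>2 = (rf_comp (radius2 a c) \<phi>2)\<^sup>2"

definition cases_a_to_d :: "(ratfun \<times> ratfun \<times> (real ^ 3 \<Rightarrow> real ^ 3)) set" where
  "cases_a_to_d =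
    {(rf_t, rf_t, \<lambda>p. vector [p $ 1, p $ 2, p $ 3]),
     (rf_t, - rf_t, \<lambda>p. vector [p $ 1, p $ 2, - p $ 3]),
     (- rf_t, rf_t, \<lambda>p. vector [p $ 1, - p $ 2, p $ 3]),
     (- rf_t, - rf_t, \<lambda>p. vector [p $ 1, - p $ 2, - p $ 3])}"

definition cases_e_to_h :: "(ratfun \<times> ratfun \<times> (real ^ 3 \<Rightarrow> real ^ 3)) set" where
  "cases_e_to_h =
    {(1 / rf_t, - 1 / rf_t, \<lambda>p. vector [- p $ 1, p $ 2, p $ 3]),
     (1 / rf_t, 1 / rf_t, \<lambda>p. vector [- p $ 1, p $ 2, - p $ 3]),
     (- 1 / rf_t, - 1 / rf_t, \<lambda>p. vector [- p $ 1, - p $ 2, p $ 3]),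
     (- 1 / rf_t, 1 / rf_t, \<lambda>p. vector [- p $ 1, - p $ 2, - p $ 3])}"

definition cases_a_to_h :: "(ratfun \<times> ratfun \<times> (real ^ 3 \<Rightarrow> real ^ 3)) set" where
  "cases_a_to_h = cases_a_to_d \<union> cases_e_to_h"

definition isometries_of ::
    "(ratfun \<times> ratfun \<times> (real ^ 3 \<Rightarrow> real ^ 3)) set \<Rightarrow> (real ^ 3 \<Rightarrow> real ^ 3) set" where
  "isometries_of X = {F. \<exists>\<phi>1 \<phi>2. (\<phi>1, \<phi>2, F) \<in> X}"

end

theory Submission
  imports Defs
begin

text \<open>
  The spine curves are an ellipse and a hyperbola, parametrized through the rational points
  \<open>((1 - t\<^sup>2) / (1 + t\<^sup>2), 2 t / (1 + t\<^sup>2))\<close> of the unit circle and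
  \<open>((1 + t\<^sup>2) / (1 - t\<^sup>2), 2 t / (1 - t\<^sup>2))\<close> of the unit hyperbola. Write \<open>x, y\<close> for the circle
  coordinates and \<open>x', y'\<close> for their compositions with \<open>\<phi>\<^sub>1\<close>. Condition (A2) for the first radius
  says \<open>c - f x' = s (c - f x)\<close> with a sign \<open>s\<close>, so \<open>x'\<close> is \<open>s x\<close> plus a constant. The functions
  \<open>1, x, y\<close> are linearly independent over \<open>\<real>\<close>. Comparing coefficients in the first and third
  coordinates of the identity (A1) for the ellipse therefore gives the first diagonal entry \<open>s\<close>
  of the orthogonal matrix and two zeros in its third row, and orthogonality leaves only a
  diagonal matrix with entries \<open>\<plusminus>1\<close> (\<open>orthogonal_matrix_diagonal\<close>). Now \<open>x'\<close> and \<open>y'\<close> are signed copies of \<open>x\<close> and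
  \<open>y\<close> up to constants, and \<open>x'\<^sup>2 + y'\<^sup>2 = 1 = x\<^sup>2 + y\<^sup>2\<close> together with linear independence forces
  these constants to vanish. Hence the isometry is a reflection in coordinate planes, and the
  constant in \<open>x'\<close>, which is proportional to \<open>(1 - s) c\<close>, shows that \<open>s = 1\<close> unless \<open>c = 0\<close>.

  The parameter of a conic point is recovered rationally from its coordinates
  (\<open>circ_inj\<close>, \<open>hyp_inj\<close>), so the reflection determines both Moebius transformations:
  they are \<open>\<plusminus>t\<close> if \<open>s = 1\<close> and \<open>\<plusminus>1 / t\<close> if \<open>s = -1\<close>. This is \<open>conditions_imp_signs\<close>; the
  converse \<open>signs_imp_conditions\<close> is a substitution.

  Coordinate reflections multiply by multiplying their signs, so mapping each sign to its exponent
  as a power of \<open>-1\<close> identifies the isometries with \<open>\<int>\<^sub>2\<^sup>2\<close> or \<open>\<int>\<^sub>2\<^sup>3\<close>. They preserve the cyclide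
  because \<open>y\<close> and \<open>z\<close> enter its equation only through their squares, and so does \<open>x\<close> when
  \<open>c = 0\<close>.
\<close>

(* Power series coefficients and vector components share a symbol; with both notations active, the
   number of parses of a formula grows exponentially with the number of components in it. *)
unbundle no Formal_Power_Series.fps_syntax

section \<open>Substitution in real rational functions\<close>

lemma rf_const_0 [simp]: "rf_const 0 = 0"
  and rf_const_1 [simp]: "rf_const 1 = 1"
  and rf_const_add: "rf_const (x + y) = rf_const x + rf_const y"
  and rf_const_diff: "rf_const (x - y) = rf_const x - rf_const y"
  and rf_const_minus: "rf_const (- x) = - rf_const x"
  and rf_const_mult: "rf_const (x * y) = rf_const x * rf_const y"
  by (simp_all add: rf_const_def flip: to_fract_add to_fract_diff to_fract_mult to_fract_uminus one_pCons)

lemma rf_const_eq_0_iff [simp]: "rf_const x = 0 \<longleftrightarrow> x = 0"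
  by (simp add: rf_const_def)

lemma rf_const_2 [simp]: "rf_const 2 = 2"
  using rf_const_add[of 1 1] by simp

lemma rf_2_nonzero [simp]: "(2 :: ratfun) \<noteq> 0"
  using rf_const_eq_0_iff[of 2] by (simp del: rf_const_eq_0_iff)

lemmas rf_const_simps = rf_const_add rf_const_diff rf_const_minus rf_const_mult

definition rf_eval :: "ratfun \<Rightarrow> real poly \<Rightarrow> ratfun" where
  "rf_eval s p = poly (map_poly rf_const p) s"

lemma rf_eval_0 [simp]: "rf_eval s 0 = 0"
  by (simp add: rf_eval_def)

lemma rf_eval_pCons [simp]: "rf_eval s (pCons x p) = rf_const x + s * rf_eval s p"
  by (simp add: rf_eval_def map_poly_pCons)

lemma rf_eval_add: "rf_eval s (p + q) = rf_eval s p + rf_eval s q"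
  by (induction p q rule: poly_induct2) (simp_all add: rf_const_add algebra_simps)

lemma rf_eval_smult: "rf_eval s (smult x p) = rf_const x * rf_eval s p"
  by (induction p) (simp_all add: rf_const_mult algebra_simps)

lemma rf_eval_mult: "rf_eval s (p * q) = rf_eval s p * rf_eval s q"
  by (induction p) (simp_all add: rf_eval_add rf_eval_smult algebra_simps)

lemma rf_eval_rf_t: "rf_eval rf_t p = to_fract p"
proof (induction p)
  case (pCons x p)
  have "pCons x p = [:x:] + [:0, 1:] * p"
    by simp
  then have "to_fract (pCons x p) = to_fract [:x:] + to_fract [:0, 1:] * to_fract p"
    by (simp only: to_fract_add to_fract_mult)
  with pCons.IH show ?case
    by (simp add: rf_const_def rf_t_def)
qed simp

text \<open>The reduced denominator divides any other denominator \<open>q\<close>. So \<open>q(s) \<noteq> 0\<close> alone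
  guarantees that substituting \<open>s\<close> into the reduced fraction gives the same value as
  substituting it into \<open>p / q\<close>.\<close>

lemma rf_comp_fraction:
  assumes "r * to_fract q = to_fract p" and "rf_eval s q \<noteq> 0"
  shows "rf_comp r s = rf_eval s p / rf_eval s q"
proof -
  obtain p' q' where pq': "quot_of_fract r = (p', q')"
    by (cases "quot_of_fract r")
  have q': "q' \<noteq> 0" and cop: "coprime p' q'"
    using pq' coprime_quot_of_fract[of r] snd_quot_of_fract_nonzero[of r] by auto
  have "r = to_fract p' / to_fract q'"
    using quot_to_fract_quot_of_fract[of r] pq' by (simp add: quot_to_fract_def Fract_conv_to_fract)
  then have "to_fract (p' * q) = to_fract (p * q')"
    using q' by (simp flip: assms(1))
  then have eq: "p' * q = p * q'"
    by (simp only: to_fract_eq_iff)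
  then have "q' dvd q"
    using cop by (metis coprime_commute coprime_dvd_mult_right_iff dvd_triv_right)
  then have nz: "rf_eval s q' \<noteq> 0"
    using assms(2) by (auto simp: rf_eval_mult elim!: dvdE)
  have "rf_eval s p' * rf_eval s q = rf_eval s p * rf_eval s q'"
    using arg_cong[OF eq, of "rf_eval s"] by (simp add: rf_eval_mult)
  then show ?thesis
    using nz assms(2) pq' by (simp add: rf_comp_def rf_eval_def field_simps)
qed

text \<open>Coordinates of the spine curves and radius functions are all affine functions of quotients
  with a common denominator, so this form covers every composition in (A1) and (A2).\<close>

lemma rf_comp_affine_quotient:
  assumes "rf_eval rf_t q \<noteq> 0" and "rf_eval s q \<noteq> 0"
  shows "rf_comp (rf_const k + rf_const m * (rf_eval rf_t p / rf_eval rf_t q)) s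
    = rf_const k + rf_const m * (rf_eval s p / rf_eval s q)"
proof -
  let ?P = "[:k:] * q + [:m:] * p"
  have P: "rf_eval u ?P = rf_const k * rf_eval u q + rf_const m * rf_eval u p" for u
    unfolding rf_eval_add rf_eval_mult by simp
  have "(rf_const k + rf_const m * (rf_eval rf_t p / rf_eval rf_t q)) * to_fract q = to_fract ?P"
    using assms(1) unfolding rf_eval_rf_t[symmetric] P by (simp add: distrib_right)
  from rf_comp_fraction[OF this assms(2)] show ?thesis
    unfolding P using assms(2) by (simp add: add_divide_distrib)
qed

lemma rf_comp_0 [simp]: "rf_comp 0 s = 0"
  using rf_comp_fraction[of 0 1 0 s] by (simp add: one_pCons)

section \<open>Rational points of the unit circle and the unit hyperbola\<close>

definition circ_x :: "ratfun \<Rightarrow> ratfun" where "circ_x s = (1 - s\<^sup>2) / (1 + s\<^sup>2)"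
definition circ_y :: "ratfun \<Rightarrow> ratfun" where "circ_y s = 2 * s / (1 + s\<^sup>2)"
definition hyp_x :: "ratfun \<Rightarrow> ratfun" where "hyp_x s = (1 + s\<^sup>2) / (1 - s\<^sup>2)"
definition hyp_y :: "ratfun \<Rightarrow> ratfun" where "hyp_y s = 2 * s / (1 - s\<^sup>2)"

lemma rf_t_nonzero: "rf_t \<noteq> 0"
  by (simp add: rf_t_def)

lemma rf_t_powers_linear_independent:
  assumes "rf_const x + rf_const y * rf_t + rf_const z * rf_t\<^sup>2 = 0"
  shows "x = 0 \<and> y = 0 \<and> z = 0"
proof -
  have "rf_eval rf_t [:x, y, z:] = 0"
    using assms by (simp add: algebra_simps power2_eq_square)
  then have "[:x, y, z:] = 0"
    by (simp only: rf_eval_rf_t to_fract_eq_0_iff)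
  then show ?thesis
    by simp
qed

lemma one_plus_rf_t2_nonzero: "1 + rf_t\<^sup>2 \<noteq> 0"
  and one_minus_rf_t2_nonzero: "1 - rf_t\<^sup>2 \<noteq> 0"
  using rf_t_powers_linear_independent[of 1 0 1] rf_t_powers_linear_independent[of 1 0 "-1"]
  by (auto simp: rf_const_minus)

text \<open>The denominators of the conic parametrizations survive a Moebius substitution:
  \<open>\<phi>\<^sup>2 = -1\<close> is impossible because a sum of two squares of real polynomials vanishes only if both
  do, and \<open>\<phi>\<^sup>2 = 1\<close> is impossible because \<open>\<phi>\<close> is not constant.\<close>

lemma moebius_denominators_nonzero:
  assumes "moebius_transformation \<phi>"
  shows "1 + \<phi>\<^sup>2 \<noteq> 0" and "1 - \<phi>\<^sup>2 \<noteq> 0"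
proof -
  obtain \<alpha> \<beta> \<gamma> \<delta> where det: "\<alpha> * \<delta> - \<beta> * \<gamma> \<noteq> 0"
    and \<phi>: "\<phi> = (rf_const \<alpha> * rf_t + rf_const \<beta>) / (rf_const \<gamma> * rf_t + rf_const \<delta>)"
    using assms by (auto simp: moebius_transformation_def)
  let ?N = "rf_const \<alpha> * rf_t + rf_const \<beta>" and ?D = "rf_const \<gamma> * rf_t + rf_const \<delta>"
  have D: "?D \<noteq> 0"
    using rf_t_powers_linear_independent[of \<delta> \<gamma> 0] det by (auto simp: add.commute)
  have \<phi>D: "\<phi> * ?D = ?N"
    using D \<phi> by simp
  show "1 + \<phi>\<^sup>2 \<noteq> 0"
  proof
    assume "1 + \<phi>\<^sup>2 = 0"
    then have "(1 + \<phi>\<^sup>2) * ?D\<^sup>2 = 0"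
      by simp
    then have "?D\<^sup>2 + (\<phi> * ?D)\<^sup>2 = 0"
      by (simp only: distrib_right power_mult_distrib mult_1)
    then have "?D\<^sup>2 + ?N\<^sup>2 = 0"
      by (simp only: \<phi>D)
    then have "rf_const (\<delta>\<^sup>2 + \<beta>\<^sup>2) + rf_const (2 * (\<gamma> * \<delta> + \<alpha> * \<beta>)) * rf_t
        + rf_const (\<gamma>\<^sup>2 + \<alpha>\<^sup>2) * rf_t\<^sup>2 = 0"
      by (simp add: rf_const_simps power2_eq_square algebra_simps)
    then have "\<delta>\<^sup>2 + \<beta>\<^sup>2 = 0 \<and> \<gamma>\<^sup>2 + \<alpha>\<^sup>2 = 0"
      using rf_t_powers_linear_independent by blast
    then show False
      using det by (simp add: sum_power2_eq_zero_iff)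
  qed
  \<comment> \<open>A constant value \<open>e\<close> makes the rows of the coefficient matrix proportional.\<close>
  have False if "?N = rf_const e * ?D" for e
  proof -
    from that have "rf_const (\<beta> - e * \<delta>) + rf_const (\<alpha> - e * \<gamma>) * rf_t + rf_const 0 * rf_t\<^sup>2 = 0"
      by (simp add: rf_const_simps algebra_simps)
    then have "\<beta> = e * \<delta>" "\<alpha> = e * \<gamma>"
      using rf_t_powers_linear_independent by fastforce+
    then show False
      using det by simp
  qed
  from this[of 1] this[of "-1"] have "\<phi> \<noteq> 1" "\<phi> \<noteq> - 1"
    using \<phi>D by (auto simp: rf_const_minus)
  then show "1 - \<phi>\<^sup>2 \<noteq> 0"
    using power2_eq_1_iff[of \<phi>] by auto
qed

lemma circ_mult_denominator:
  assumes "1 + s\<^sup>2 \<noteq> 0"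
  shows "circ_x s * (1 + s\<^sup>2) = 1 - s\<^sup>2" and "circ_y s * (1 + s\<^sup>2) = 2 * s"
  using assms by (simp_all add: circ_x_def circ_y_def)

lemma circ_on_circle: "1 + s\<^sup>2 \<noteq> 0 \<Longrightarrow> (circ_x s)\<^sup>2 + (circ_y s)\<^sup>2 = 1"
  by (simp add: circ_x_def circ_y_def power_divide flip: add_divide_distrib)
    (simp add: power2_eq_square algebra_simps)

text \<open>The parameter is the slope of the chord from \<open>(-1, 0)\<close>, i.e. \<open>y / (1 + x)\<close>, on both
  conics.\<close>

lemma circ_inj:
  assumes "1 + s\<^sup>2 \<noteq> 0" "1 + r\<^sup>2 \<noteq> 0" "circ_x s = circ_x r" "circ_y s = circ_y r"
  shows "s = r"
proof -
  have *: "u = circ_y u / (1 + circ_x u)" if "1 + u\<^sup>2 \<noteq> 0" for u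
    using that by (simp add: circ_x_def circ_y_def divide_simps)
  show ?thesis
    using *[OF assms(1)] *[OF assms(2)] assms(3,4) by simp
qed

lemma hyp_inj:
  assumes "1 - s\<^sup>2 \<noteq> 0" "1 - r\<^sup>2 \<noteq> 0" "hyp_x s = hyp_x r" "hyp_y s = hyp_y r"
  shows "s = r"
proof -
  have *: "u = hyp_y u / (1 + hyp_x u)" if "1 - u\<^sup>2 \<noteq> 0" for u
    using that by (simp add: hyp_x_def hyp_y_def divide_simps)
  show ?thesis
    using *[OF assms(1)] *[OF assms(2)] assms(3,4) by simp
qed

text \<open>An affine relation between \<open>x\<close> and \<open>y\<close> would put the whole circle on a line. This is the tool
  by which identities of rational functions turn into equations between real coefficients.\<close>

lemma circ_linear_independent:
  assumes "rf_const x * circ_x rf_t + rf_const y * circ_y rf_t + rf_const z = 0"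
  shows "x = 0" "y = 0" "z = 0"
proof -
  have "(rf_const x * circ_x rf_t + rf_const y * circ_y rf_t + rf_const z) * (1 + rf_t\<^sup>2)
      = rf_const (z + x) + rf_const (2 * y) * rf_t + rf_const (z - x) * rf_t\<^sup>2"
    using circ_mult_denominator[OF one_plus_rf_t2_nonzero]
    by (simp add: distrib_right mult.assoc rf_const_simps) (simp add: algebra_simps)
  then have "z + x = 0 \<and> 2 * y = 0 \<and> z - x = 0"
    using rf_t_powers_linear_independent[of "z + x" "2 * y" "z - x"] assms by simp
  then show "x = 0" "y = 0" "z = 0"
    by auto
qed

lemma rf_eval_conic_polynomials:
  "rf_eval s [:1, 0, 1:] = 1 + s\<^sup>2" "rf_eval s [:1, 0, -1:] = 1 - s\<^sup>2" "rf_eval s [:0, 2:] = 2 * s"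
  by (simp_all add: power2_eq_square rf_const_minus mult.commute)

lemma rf_comp_circ:
  assumes "1 + s\<^sup>2 \<noteq> 0"
  shows "rf_comp (circ_x rf_t * rf_const a) s = circ_x s * rf_const a"
    and "rf_comp (circ_y rf_t * rf_const b) s = circ_y s * rf_const b"
    and "rf_comp (rf_const c - rf_const f * circ_x rf_t) s = rf_const c - rf_const f * circ_x s"
proof -
  have *: "rf_comp (rf_const k + rf_const m * circ_x rf_t) s = rf_const k + rf_const m * circ_x s"
    "rf_comp (rf_const k + rf_const m * circ_y rf_t) s = rf_const k + rf_const m * circ_y s" for k m
    using rf_comp_affine_quotient[of "[:1, 0, 1:]" s k m "[:1, 0, -1:]"]
      rf_comp_affine_quotient[of "[:1, 0, 1:]" s k m "[:0, 2:]"] assms one_plus_rf_t2_nonzero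
    unfolding rf_eval_conic_polynomials circ_x_def circ_y_def by blast+
  show "rf_comp (circ_x rf_t * rf_const a) s = circ_x s * rf_const a"
    "rf_comp (circ_y rf_t * rf_const b) s = circ_y s * rf_const b"
    "rf_comp (rf_const c - rf_const f * circ_x rf_t) s = rf_const c - rf_const f * circ_x s"
    using *[of 0 a] *[of 0 b] *[of c "- f"] by (simp_all add: rf_const_minus mult.commute)
qed

lemma rf_comp_hyp:
  assumes "1 - s\<^sup>2 \<noteq> 0"
  shows "rf_comp (hyp_x rf_t * rf_const a) s = hyp_x s * rf_const a"
    and "rf_comp (hyp_y rf_t * rf_const b) s = hyp_y s * rf_const b"
    and "rf_comp (rf_const c - rf_const f * hyp_x rf_t) s = rf_const c - rf_const f * hyp_x s"
proof -
  have *: "rf_comp (rf_const k + rf_const m * hyp_x rf_t) s = rf_const k + rf_const m * hyp_x s"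
    "rf_comp (rf_const k + rf_const m * hyp_y rf_t) s = rf_const k + rf_const m * hyp_y s" for k m
    using rf_comp_affine_quotient[of "[:1, 0, -1:]" s k m "[:1, 0, 1:]"]
      rf_comp_affine_quotient[of "[:1, 0, -1:]" s k m "[:0, 2:]"] assms one_minus_rf_t2_nonzero
    unfolding rf_eval_conic_polynomials hyp_x_def hyp_y_def by blast+
  show "rf_comp (hyp_x rf_t * rf_const a) s = hyp_x s * rf_const a"
    "rf_comp (hyp_y rf_t * rf_const b) s = hyp_y s * rf_const b"
    "rf_comp (rf_const c - rf_const f * hyp_x rf_t) s = rf_const c - rf_const f * hyp_x s"
    using *[of 0 a] *[of 0 b] *[of c "- f"] by (simp_all add: rf_const_minus mult.commute)
qed

section \<open>The conditions in conic coordinates\<close>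

lemma vec3_eq_iff: "v = w \<longleftrightarrow> v $ 1 = w $ 1 \<and> v $ 2 = w $ 2 \<and> v $ 3 = w $ 3" for v w :: "'a ^ 3"
  by (simp add: vec_eq_iff forall_3)

lemma affine_curve_nth:
  "affine_curve Q w C $ i = rf_const (Q $ i $ 1) * C $ 1 + rf_const (Q $ i $ 2) * C $ 2
     + rf_const (Q $ i $ 3) * C $ 3 + rf_const (w $ i)"
  by (simp add: affine_curve_def map_matrix_def matrix_vector_mult_def sum_3)

lemma condition_A1_iff:
  assumes "1 + \<phi>1\<^sup>2 \<noteq> 0" and "1 - \<phi>2\<^sup>2 \<noteq> 0"
  shows "condition_A1 a b f Q w \<phi>1 \<phi>2 \<longleftrightarrow>
    (\<forall>i. rf_const (Q $ i $ 1) * (circ_x rf_t * rf_const a)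
        + rf_const (Q $ i $ 2) * (circ_y rf_t * rf_const b) + rf_const (w $ i)
       = vector [circ_x \<phi>1 * rf_const a, circ_y \<phi>1 * rf_const b, 0] $ i) \<and>
    (\<forall>i. rf_const (Q $ i $ 1) * (hyp_x rf_t * rf_const f)
        + rf_const (Q $ i $ 3) * (hyp_y rf_t * rf_const b) + rf_const (w $ i)
       = vector [hyp_x \<phi>2 * rf_const f, 0, hyp_y \<phi>2 * rf_const b] $ i)"
proof -
  have s1: "spine1 a b = vector [circ_x rf_t * rf_const a, circ_y rf_t * rf_const b, 0]"
    by (simp add: spine1_def circ_x_def circ_y_def)
  have s2: "spine2 b f = vector [hyp_x rf_t * rf_const f, 0, hyp_y rf_t * rf_const b]"
    by (simp add: spine2_def hyp_x_def hyp_y_def)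
  show ?thesis
    using rf_comp_circ[OF assms(1)] rf_comp_hyp[OF assms(2)]
    by (simp add: condition_A1_def s1 s2 vec3_eq_iff forall_3 affine_curve_nth curve_comp_def)
qed

lemma condition_A2_iff:
  assumes "1 + \<phi>1\<^sup>2 \<noteq> 0" and "1 - \<phi>2\<^sup>2 \<noteq> 0"
  shows "condition_A2 a c f \<phi>1 \<phi>2 \<longleftrightarrow>
    (rf_const c - rf_const f * circ_x rf_t)\<^sup>2 = (rf_const c - rf_const f * circ_x \<phi>1)\<^sup>2 \<and>
    (rf_const c - rf_const a * hyp_x rf_t)\<^sup>2 = (rf_const c - rf_const a * hyp_x \<phi>2)\<^sup>2"
proof -
  have "radius1 c f = rf_const c - rf_const f * circ_x rf_t"
    "radius2 a c = rf_const c - rf_const a * hyp_x rf_t"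
    by (simp_all add: radius1_def radius2_def circ_x_def hyp_x_def)
  then show ?thesis
    using rf_comp_circ(3)[OF assms(1)] rf_comp_hyp(3)[OF assms(2)]
    by (simp add: condition_A2_def)
qed

definition signs :: "real set" where "signs = {1, -1}"

lemma sign_closed: "1 \<in> signs" "s \<in> signs \<Longrightarrow> r \<in> signs \<Longrightarrow> s * r \<in> signs"
  by (auto simp: signs_def)

text \<open>The reparametrization \<open>\<sigma> t\<^sup>s\<close>. By \<open>signed_parameter_conic\<close> below, it multiplies the circle
  coordinates by \<open>s\<close> and \<open>\<sigma>\<close> and the hyperbola coordinates by \<open>s\<close> and \<open>\<sigma> s\<close>; so all eight pairs
  of Moebius transformations have the form \<open>(\<sigma>\<^sub>2 t\<^sup>s, s \<sigma>\<^sub>3 t\<^sup>s)\<close>, where \<open>s, \<sigma>\<^sub>2, \<sigma>\<^sub>3\<close> are the signs of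
  the isometry.\<close>

definition signed_parameter :: "real \<Rightarrow> real \<Rightarrow> ratfun" where
  "signed_parameter \<sigma> s = rf_const \<sigma> * (if s = 1 then rf_t else 1 / rf_t)"

lemma signed_parameter_conic:
  assumes "\<sigma> \<in> signs" "s \<in> signs"
  shows "1 + (signed_parameter \<sigma> s)\<^sup>2 \<noteq> 0" "1 - (signed_parameter \<sigma> s)\<^sup>2 \<noteq> 0"
    "circ_x (signed_parameter \<sigma> s) = rf_const s * circ_x rf_t"
    "circ_y (signed_parameter \<sigma> s) = rf_const \<sigma> * circ_y rf_t"
    "hyp_x (signed_parameter \<sigma> s) = rf_const s * hyp_x rf_t"
    "hyp_y (signed_parameter \<sigma> s) = rf_const (\<sigma> * s) * hyp_y rf_t"
proof -
  have nz: "rf_t \<noteq> 0" "1 + rf_t\<^sup>2 \<noteq> 0" "1 - rf_t\<^sup>2 \<noteq> 0" "rf_t\<^sup>2 + 1 \<noteq> 0" "rf_t\<^sup>2 - 1 \<noteq> 0" "rf_t\<^sup>2 \<noteq> 1"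
    using rf_t_nonzero one_plus_rf_t2_nonzero one_minus_rf_t2_nonzero by (auto simp: add.commute)
  define r where "r = 1 / rf_t"
  have r: "1 + r\<^sup>2 = (1 + rf_t\<^sup>2) / rf_t\<^sup>2" "1 - r\<^sup>2 = - (1 - rf_t\<^sup>2) / rf_t\<^sup>2"
    using nz by (simp_all add: r_def power_divide add_divide_distrib diff_divide_distrib)
  have swap: "rf_t * rf_t - 1 = - (1 - rf_t * rf_t)"
    by simp
  have cr: "circ_x r = - circ_x rf_t" "circ_y r = circ_y rf_t" "hyp_x r = - hyp_x rf_t" "hyp_y r = - hyp_y rf_t"
    unfolding circ_x_def circ_y_def hyp_x_def hyp_y_def r using nz
    by (simp_all add: r_def power2_eq_square)
      (simp_all only: swap divide_minus_left divide_minus_right)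
  have r_nz: "1 + r\<^sup>2 \<noteq> 0" "1 - r\<^sup>2 \<noteq> 0"
    using nz by (simp_all add: r)
  have neg: "circ_x (- u) = circ_x u" "circ_y (- u) = - circ_y u" "hyp_x (- u) = hyp_x u" "hyp_y (- u) = - hyp_y u" for u
    by (simp_all add: circ_x_def circ_y_def hyp_x_def hyp_y_def)
  have "signed_parameter \<sigma> s = (if s = 1 then (if \<sigma> = 1 then rf_t else - rf_t) else (if \<sigma> = 1 then r else - r))"
    using assms by (auto simp: signed_parameter_def signs_def r_def rf_const_minus)
  then show "1 + (signed_parameter \<sigma> s)\<^sup>2 \<noteq> 0" "1 - (signed_parameter \<sigma> s)\<^sup>2 \<noteq> 0"
    "circ_x (signed_parameter \<sigma> s) = rf_const s * circ_x rf_t"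
    "circ_y (signed_parameter \<sigma> s) = rf_const \<sigma> * circ_y rf_t"
    "hyp_x (signed_parameter \<sigma> s) = rf_const s * hyp_x rf_t"
    "hyp_y (signed_parameter \<sigma> s) = rf_const (\<sigma> * s) * hyp_y rf_t"
    using assms nz r_nz by (auto simp: signs_def cr neg rf_const_minus)
qed

section \<open>Coordinate reflections\<close>

definition axis_reflection :: "real \<Rightarrow> real \<Rightarrow> real \<Rightarrow> real ^ 3 \<Rightarrow> real ^ 3" where
  "axis_reflection s1 s2 s3 = (\<lambda>p. vector [s1 * p $ 1, s2 * p $ 2, s3 * p $ 3])"

lemma affine_map_eq_axis_reflection_iff:
  "affine_map Q w = axis_reflection s1 s2 s3 \<longleftrightarrow>
    Q = vector [vector [s1, 0, 0], vector [0, s2, 0], vector [0, 0, s3]] \<and> w = 0"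
proof
  assume eq: "affine_map Q w = axis_reflection s1 s2 s3"
  have at: "Q *v p + w = vector [s1 * p $ 1, s2 * p $ 2, s3 * p $ 3]" for p
    using fun_cong[OF eq, of p] by (simp add: affine_map_def axis_reflection_def)
  have w: "w = 0"
    using at[of 0] by (simp add: vec3_eq_iff)
  show "Q = vector [vector [s1, 0, 0], vector [0, s2, 0], vector [0, 0, s3]] \<and> w = 0"
    using w at[of "axis 1 1"] at[of "axis 2 1"] at[of "axis 3 1"]
    by (simp add: vec3_eq_iff matrix_vector_mult_basis column_def) (simp add: axis_def)
qed (auto simp: affine_map_def axis_reflection_def vec3_eq_iff matrix_vector_mult_def sum_3)

lemma orthogonal_3_rows_cols:
  fixes Q :: "real ^ 3 ^ 3"
  assumes "orthogonal_matrix Q"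
  shows "Q $ i $ 1 * Q $ j $ 1 + Q $ i $ 2 * Q $ j $ 2 + Q $ i $ 3 * Q $ j $ 3 = (if i = j then 1 else 0)"
    and "Q $ 1 $ i * Q $ 1 $ j + Q $ 2 $ i * Q $ 2 $ j + Q $ 3 $ i * Q $ 3 $ j = (if i = j then 1 else 0)"
proof -
  have "Q ** transpose Q = mat 1" "transpose Q ** Q = mat 1"
    using assms by (simp_all add: orthogonal_matrix_def)
  then show "Q $ i $ 1 * Q $ j $ 1 + Q $ i $ 2 * Q $ j $ 2 + Q $ i $ 3 * Q $ j $ 3 = (if i = j then 1 else 0)"
    "Q $ 1 $ i * Q $ 1 $ j + Q $ 2 $ i * Q $ 2 $ j + Q $ 3 $ i * Q $ 3 $ j = (if i = j then 1 else 0)"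
    by (simp_all add: vec_eq_iff matrix_matrix_mult_def transpose_def mat_def sum_3)
qed

text \<open>The entry \<open>\<plusminus>1\<close> already exhausts the norm of the first row and the first column, and the two
  zeros leave only the last entry for the norm of the third row; so all remaining off-diagonal
  entries vanish.\<close>

lemma orthogonal_matrix_diagonal:
  fixes Q :: "real ^ 3 ^ 3"
  assumes "orthogonal_matrix Q" "Q $ 1 $ 1 = s1" "s1 \<in> signs" "Q $ 3 $ 1 = 0" "Q $ 3 $ 2 = 0"
  shows "\<exists>s2\<in>signs. \<exists>s3\<in>signs. Q = vector [vector [s1, 0, 0], vector [0, s2, 0], vector [0, 0, s3]]"
proof -
  note rows = orthogonal_3_rows_cols(1)[OF assms(1)] and cols = orthogonal_3_rows_cols(2)[OF assms(1)]
  have s1: "s1 * s1 = 1"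
    using assms(3) by (auto simp: signs_def)
  have "Q $ 1 $ 2 * Q $ 1 $ 2 + Q $ 1 $ 3 * Q $ 1 $ 3 = 0"
    using rows[of 1 1] assms(2) s1 by simp
  then have r1: "Q $ 1 $ 2 = 0" "Q $ 1 $ 3 = 0"
    by (simp_all add: sum_squares_eq_zero_iff)
  have c1: "Q $ 2 $ 1 = 0"
    using cols[of 1 1] assms(2,4) s1 by simp
  have q33: "Q $ 3 $ 3 * Q $ 3 $ 3 = 1"
    using rows[of 3 3] assms(4,5) by simp
  have c3: "Q $ 2 $ 3 = 0"
    using cols[of 3 3] r1 q33 by simp
  have q22: "Q $ 2 $ 2 * Q $ 2 $ 2 = 1"
    using rows[of 2 2] c1 c3 by simp
  have "Q $ 2 $ 2 \<in> signs" "Q $ 3 $ 3 \<in> signs"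
    using q22 q33 by (simp_all add: signs_def square_eq_1_iff)
  moreover have "Q = vector [vector [s1, 0, 0], vector [0, Q $ 2 $ 2, 0], vector [0, 0, Q $ 3 $ 3]]"
    using assms(2,4,5) r1 c1 c3 by (simp add: vec3_eq_iff)
  ultimately show ?thesis
    by blast
qed

lemma cases_a_to_d_eq:
  "cases_a_to_d = (\<Union>s2\<in>signs. \<Union>s3\<in>signs.
     {(signed_parameter s2 1, signed_parameter s3 1, axis_reflection 1 s2 s3)})"
  by (simp add: cases_a_to_d_def signed_parameter_def signs_def axis_reflection_def rf_const_minus
      insert_commute)

lemma cases_a_to_h_eq:
  "cases_a_to_h = (\<Union>s1\<in>signs. \<Union>s2\<in>signs. \<Union>s3\<in>signs.
     {(signed_parameter s2 s1, signed_parameter (s1 * s3) s1, axis_reflection s1 s2 s3)})"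
  by (simp add: cases_a_to_h_def cases_a_to_d_def cases_e_to_h_def
      signed_parameter_def signs_def axis_reflection_def rf_const_minus insert_commute)

section \<open>Solving the conditions\<close>

text \<open>The ellipse and its radius function restrict the isometry to a coordinate reflection and
  determine \<open>\<phi>1\<close>; the hyperbola then determines \<open>\<phi>2\<close> from the reflection.\<close>

lemma conditions_imp_signs:
  assumes nz: "a \<noteq> 0" "b \<noteq> 0" "f \<noteq> 0"
    and orth: "orthogonal_matrix Q"
    and \<phi>1: "1 + \<phi>1\<^sup>2 \<noteq> 0" and \<phi>2: "1 - \<phi>2\<^sup>2 \<noteq> 0"
    and A1: "condition_A1 a b f Q w \<phi>1 \<phi>2" and A2: "condition_A2 a c f \<phi>1 \<phi>2"
  shows "\<exists>s1\<in>signs. \<exists>s2\<in>signs. \<exists>s3\<in>signs. (c \<noteq> 0 \<longrightarrow> s1 = 1) \<and> \<phi>1 = signed_parameter s2 s1 \<and>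
    \<phi>2 = signed_parameter (s1 * s3) s1 \<and> affine_map Q w = axis_reflection s1 s2 s3"
proof -
  let ?x = "circ_x rf_t" and ?y = "circ_y rf_t"
  note E1 = conjunct1[OF A1[unfolded condition_A1_iff[OF \<phi>1 \<phi>2]], rule_format]
  note E2 = conjunct2[OF A1[unfolded condition_A1_iff[OF \<phi>1 \<phi>2]], rule_format]
  note E11 = E1[of 1, unfolded vector_3] and E12 = E1[of 2, unfolded vector_3]
    and E13 = E1[of 3, unfolded vector_3]
    and E21 = E2[of 1, unfolded vector_3] and E23 = E2[of 3, unfolded vector_3]
  have "(rf_const c - rf_const f * circ_x \<phi>1)\<^sup>2 = (rf_const c - rf_const f * ?x)\<^sup>2"
    using A2 condition_A2_iff[OF \<phi>1 \<phi>2] by simp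
  then obtain s1 where s1: "s1 \<in> signs"
    and r: "rf_const c - rf_const f * circ_x \<phi>1 = rf_const s1 * (rf_const c - rf_const f * ?x)"
    unfolding power2_eq_iff signs_def
    by (metis insertCI mult_1 mult_minus_left rf_const_1 rf_const_minus)
  \<comment> \<open>Eliminate the first coordinate of \<open>c\<^sub>1 \<circ> \<phi>1\<close> between (A1) and the sign equation \<open>r\<close>.\<close>
  have "rf_const (f * (Q $ 1 $ 1 * a) - a * (s1 * f)) * ?x + rf_const (f * (Q $ 1 $ 2 * b)) * ?y
      + rf_const (f * w $ 1 - a * (c - s1 * c))
    = rf_const f * (rf_const (Q $ 1 $ 1) * (?x * rf_const a) + rf_const (Q $ 1 $ 2) * (?y * rf_const b)
      + rf_const (w $ 1)) - rf_const a * (rf_const c - rf_const s1 * (rf_const c - rf_const f * ?x))"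
    by (simp add: rf_const_simps algebra_simps)
  also have "\<dots> = rf_const f * (circ_x \<phi>1 * rf_const a) - rf_const a * (rf_const f * circ_x \<phi>1)"
    by (simp add: E11 flip: r)
  finally have "rf_const (f * (Q $ 1 $ 1 * a) - a * (s1 * f)) * ?x + rf_const (f * (Q $ 1 $ 2 * b)) * ?y
      + rf_const (f * w $ 1 - a * (c - s1 * c)) = 0"
    by simp
  from circ_linear_independent[OF this] have Q11: "Q $ 1 $ 1 = s1"
    and w1c: "f * w $ 1 = a * (c - s1 * c)"
    using nz by auto
  have "rf_const (Q $ 3 $ 1 * a) * ?x + rf_const (Q $ 3 $ 2 * b) * ?y + rf_const (w $ 3) = 0"
    using E13 by (simp add: rf_const_mult ac_simps)
  from circ_linear_independent[OF this] have Q3: "Q $ 3 $ 1 = 0" "Q $ 3 $ 2 = 0" and w3: "w $ 3 = 0"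
    using nz by auto
  obtain s2 s3 where s23: "s2 \<in> signs" "s3 \<in> signs"
    and Q: "Q = vector [vector [s1, 0, 0], vector [0, s2, 0], vector [0, 0, s3]]"
    using orthogonal_matrix_diagonal[OF orth Q11 s1 Q3] by blast
  have sq: "s1 * s1 = 1" "s2 * s2 = 1"
    using s1 s23 by (auto simp: signs_def)
  let ?A = "rf_const a" and ?B = "rf_const b" and ?S = "rf_const s1" and ?T = "rf_const s2"
    and ?v = "rf_const (w $ 1)" and ?w = "rf_const (w $ 2)"
  have ST: "?S * ?S = 1" "?T * ?T = 1"
    using sq by (simp_all flip: rf_const_mult)
  have x': "circ_x \<phi>1 * ?A = ?S * ?x * ?A + ?v" and y': "circ_y \<phi>1 * ?B = ?T * ?y * ?B + ?w"
    using E11 E12 by (simp_all add: Q mult.assoc)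
  have circ: "?x\<^sup>2 + ?y\<^sup>2 = 1" "(circ_x \<phi>1)\<^sup>2 + (circ_y \<phi>1)\<^sup>2 = 1"
    using circ_on_circle one_plus_rf_t2_nonzero \<phi>1 by simp_all
  \<comment> \<open>Both \<open>(x, y)\<close> and its composition with \<open>\<phi>1\<close> lie on the circle, so the quadratic terms cancel and a
    linear relation with the translation in its coefficients remains.\<close>
  have "?B\<^sup>2 * (?S * ?x * ?A + ?v)\<^sup>2 + ?A\<^sup>2 * (?T * ?y * ?B + ?w)\<^sup>2
      = ?A\<^sup>2 * ?B\<^sup>2 * ((circ_x \<phi>1)\<^sup>2 + (circ_y \<phi>1)\<^sup>2)"
    unfolding x'[symmetric] y'[symmetric] by (simp only: power_mult_distrib distrib_left ac_simps)
  then have eq: "?B\<^sup>2 * (?S * ?x * ?A + ?v)\<^sup>2 + ?A\<^sup>2 * (?T * ?y * ?B + ?w)\<^sup>2 = ?A\<^sup>2 * ?B\<^sup>2"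
    by (simp add: circ)
  have "rf_const (2 * (b * b * s1 * a * w $ 1)) * ?x + rf_const (2 * (a * a * s2 * b * w $ 2)) * ?y
      + rf_const (b * b * (w $ 1 * w $ 1) + a * a * (w $ 2 * w $ 2))
    = ?B\<^sup>2 * (?S * ?x * ?A + ?v)\<^sup>2 + ?A\<^sup>2 * (?T * ?y * ?B + ?w)\<^sup>2
      - ?A\<^sup>2 * ?B\<^sup>2 * ((?S * ?S) * ?x\<^sup>2 + (?T * ?T) * ?y\<^sup>2)"
    by (simp add: rf_const_simps power2_eq_square algebra_simps)
  also have "\<dots> = 0"
    unfolding eq ST by (simp add: circ)
  finally have "rf_const (2 * (b * b * s1 * a * w $ 1)) * ?x + rf_const (2 * (a * a * s2 * b * w $ 2)) * ?y
      + rf_const (b * b * (w $ 1 * w $ 1) + a * a * (w $ 2 * w $ 2)) = 0" .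
  from circ_linear_independent[OF this] have w12: "w $ 1 = 0" "w $ 2 = 0"
    using nz sq by auto
  have w: "w = 0"
    using w12 w3 by (simp add: vec3_eq_iff)
  have c: "c \<noteq> 0 \<longrightarrow> s1 = 1"
    using w1c w12 nz by auto
  have p: "\<phi>1 = signed_parameter s2 s1"
  proof (rule circ_inj[OF \<phi>1 signed_parameter_conic(1)[OF s23(1) s1]])
    show "circ_x \<phi>1 = circ_x (signed_parameter s2 s1)" "circ_y \<phi>1 = circ_y (signed_parameter s2 s1)"
      using x' y' w nz by (simp_all add: signed_parameter_conic[OF s23(1) s1])
  qed
  have s13: "s1 * s3 \<in> signs" "s1 * s3 * s1 = s3"
    using s1 s23 by (auto simp: signs_def)
  have "\<phi>2 = signed_parameter (s1 * s3) s1"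
  proof (rule hyp_inj[OF \<phi>2 signed_parameter_conic(2)[OF s13(1) s1]])
    show "hyp_x \<phi>2 = hyp_x (signed_parameter (s1 * s3) s1)" "hyp_y \<phi>2 = hyp_y (signed_parameter (s1 * s3) s1)"
      using E21 E23 w nz by (simp_all add: signed_parameter_conic[OF s13(1) s1] s13 Q flip: mult.assoc)
  qed
  then show ?thesis
    using s1 s23 c p w Q affine_map_eq_axis_reflection_iff by blast
qed

lemma signs_imp_conditions:
  assumes s: "s1 \<in> signs" "s2 \<in> signs" "s3 \<in> signs"
    and c: "c \<noteq> 0 \<longrightarrow> s1 = 1"
    and F: "affine_map Q w = axis_reflection s1 s2 s3"
  shows "condition_A1 a b f Q w (signed_parameter s2 s1) (signed_parameter (s1 * s3) s1)" (is ?A1)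
    and "condition_A2 a c f (signed_parameter s2 s1) (signed_parameter (s1 * s3) s1)" (is ?A2)
proof -
  have s13: "s1 * s3 \<in> signs" "s1 * s3 * s1 = s3"
    using s by (auto simp: signs_def)
  note conic = signed_parameter_conic[OF s(2) s(1)] signed_parameter_conic[OF s13(1) s(1)]
  show ?A1
    using F conic s13
    by (simp add: condition_A1_iff affine_map_eq_axis_reflection_iff forall_3)
  show ?A2
    using s(1) c conic by (cases "c = 0") (auto simp: condition_A2_iff signs_def rf_const_minus)
qed

section \<open>The symmetry groups\<close>

lemma axis_reflection_comp:
  "axis_reflection s1 s2 s3 \<circ> axis_reflection r1 r2 r3 = axis_reflection (s1 * r1) (s2 * r2) (s3 * r3)"
  by (simp add: axis_reflection_def fun_eq_iff vec3_eq_iff)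

lemma axis_reflection_id: "axis_reflection 1 1 1 = id"
  by (simp add: axis_reflection_def fun_eq_iff vec3_eq_iff)

lemma isometry3_axis_reflection:
  assumes "s1 \<in> signs" "s2 \<in> signs" "s3 \<in> signs"
  shows "isometry3 (axis_reflection s1 s2 s3)"
proof -
  let ?D = "vector [vector [s1, 0, 0], vector [0, s2, 0], vector [0, 0, s3]] :: real ^ 3 ^ 3"
  have "orthogonal_matrix ?D"
    using assms
    by (auto simp: orthogonal_matrix vec3_eq_iff matrix_matrix_mult_def transpose_def mat_def sum_3 signs_def)
  moreover have "axis_reflection s1 s2 s3 = affine_map ?D 0"
    using affine_map_eq_axis_reflection_iff by metis
  ultimately show ?thesis
    by (auto simp: isometry3_def)
qed

lemma axis_reflection_dupin_cyclide:
  assumes "s1 \<in> signs" "s2 \<in> signs" "s3 \<in> signs" "c \<noteq> 0 \<longrightarrow> s1 = 1"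
  shows "axis_reflection s1 s2 s3 ` dupin_cyclide_II a c f = dupin_cyclide_II a c f"
proof -
  let ?R = "axis_reflection s1 s2 s3" and ?S = "dupin_cyclide_II a c f"
  have "?R ` ?S \<subseteq> ?S"
    using assms by (auto simp: dupin_cyclide_II_def axis_reflection_def signs_def Let_def)
  moreover have "?R (?R p) = p" for p
    using assms by (auto simp: axis_reflection_def vec3_eq_iff signs_def)
  ultimately show ?thesis
    by (metis image_eqI image_subset_iff subsetI subset_antisym)
qed

text \<open>Each coordinate reflection is its own inverse, so closure under composition gives closure
  under inverses.\<close>

lemma subgroup_axis_reflections:
  assumes sub: "H \<subseteq> {axis_reflection s1 s2 s3 | s1 s2 s3. s1 \<in> signs \<and> s2 \<in> signs \<and> s3 \<in> signs}"
    and sym: "\<And>F. F \<in> H \<Longrightarrow> F ` S = S"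
    and closed: "\<And>F G. F \<in> H \<Longrightarrow> G \<in> H \<Longrightarrow> F \<circ> G \<in> H" and id: "id \<in> H"
  shows "subgroup H (symmetry_group S)"
proof -
  have carrier: "H \<subseteq> carrier (symmetry_group S)"
    using sub sym isometry3_axis_reflection by (fastforce simp: symmetry_group_def)
  have inv: "inv\<^bsub>symmetry_group S\<^esub> F = F" if F: "F \<in> H" for F
  proof -
    have invol: "F \<circ> F = id"
      using F sub by (auto simp: axis_reflection_comp signs_def simp flip: axis_reflection_id)
    have "G = F" if "F \<circ> G = id" for G
      using invol that by (metis comp_assoc comp_id id_comp)
    then show ?thesis
      unfolding m_inv_def using F carrier invol
      by (intro the_equality) (auto simp: symmetry_group_def)
  qed
  show ?thesis
    using carrier closed id inv by unfold_locales (auto simp: symmetry_group_def)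
qed

definition sign_exponent :: "real \<Rightarrow> int" where
  "sign_exponent s = (if s = 1 then 0 else 1)"

lemma sign_exponent_mult:
  "s \<in> signs \<Longrightarrow> r \<in> signs \<Longrightarrow> sign_exponent (s * r) = (sign_exponent s + sign_exponent r) mod 2"
  by (auto simp: sign_exponent_def signs_def)

lemma isometries_of_cases:
  "isometries_of cases_a_to_d = (\<Union>s2\<in>signs. \<Union>s3\<in>signs. {axis_reflection 1 s2 s3})"
  "isometries_of cases_a_to_h = (\<Union>s1\<in>signs. \<Union>s2\<in>signs. \<Union>s3\<in>signs. {axis_reflection s1 s2 s3})"
  unfolding isometries_of_def cases_a_to_d_eq cases_a_to_h_eq by blast+

text \<open>The signs of a coordinate reflection can be read off from the image of \<open>(1, 1, 1)\<close>; this
  provides the isomorphisms to the powers of \<open>\<int>\<^sub>2\<close>.\<close>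

lemma axis_reflection_at_1:
  "axis_reflection s1 s2 s3 1 $ 1 = s1" "axis_reflection s1 s2 s3 1 $ 2 = s2"
  "axis_reflection s1 s2 s3 1 $ 3 = s3"
  by (simp_all add: axis_reflection_def)

lemma carrier_Z2: "carrier (integer_mod_group 2) = {0, 1}"
  by (auto simp: carrier_integer_mod_group)

lemma sign_exponent_in_Z2: "sign_exponent s \<in> carrier (integer_mod_group 2)"
  by (simp add: carrier_Z2 sign_exponent_def)

lemma isometries_a_to_d_group:
  assumes "c \<noteq> 0"
  shows "subgroup (isometries_of cases_a_to_d) (symmetry_group (dupin_cyclide_II a c f))"
    and "(symmetry_group (dupin_cyclide_II a c f)) \<lparr>carrier := isometries_of cases_a_to_d\<rparr>
      \<cong> integer_mod_group 2 \<times>\<times> integer_mod_group 2"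
proof -
  show "subgroup (isometries_of cases_a_to_d) (symmetry_group (dupin_cyclide_II a c f))"
  proof (rule subgroup_axis_reflections)
    show "isometries_of cases_a_to_d
        \<subseteq> {axis_reflection s1 s2 s3 | s1 s2 s3. s1 \<in> signs \<and> s2 \<in> signs \<and> s3 \<in> signs}"
      unfolding isometries_of_cases using sign_closed(1) by blast
    show "F ` dupin_cyclide_II a c f = dupin_cyclide_II a c f" if "F \<in> isometries_of cases_a_to_d" for F
      using that sign_closed(1) unfolding isometries_of_cases UN_iff singleton_iff
      by (elim bexE) (simp add: axis_reflection_dupin_cyclide)
    show "F \<circ> G \<in> isometries_of cases_a_to_d"
      if "F \<in> isometries_of cases_a_to_d" "G \<in> isometries_of cases_a_to_d" for F G
      using that unfolding isometries_of_cases UN_iff singleton_iff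
      by (elim bexE) (metis axis_reflection_comp sign_closed mult_1)
    show "id \<in> isometries_of cases_a_to_d"
      using sign_closed(1) by (auto simp: isometries_of_cases simp flip: axis_reflection_id)
  qed
  let ?G = "(symmetry_group (dupin_cyclide_II a c f)) \<lparr>carrier := isometries_of cases_a_to_d\<rparr>"
  let ?h = "\<lambda>F. (sign_exponent (F 1 $ 2), sign_exponent (F 1 $ 3))"
  have "?h \<in> hom ?G (integer_mod_group 2 \<times>\<times> integer_mod_group 2)"
    by (rule homI)
      (auto simp: isometries_of_cases symmetry_group_def axis_reflection_comp axis_reflection_at_1
        sign_exponent_mult sign_exponent_in_Z2 simp del: o_apply)
  moreover have "inj_on ?h (isometries_of cases_a_to_d)"
    by (auto simp: inj_on_def isometries_of_cases axis_reflection_at_1 sign_exponent_def signs_def)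
  moreover have "?h ` isometries_of cases_a_to_d = {0, 1} \<times> {0, 1}"
    by (auto simp: isometries_of_cases axis_reflection_at_1 sign_exponent_def signs_def image_UN)
  ultimately have "?h \<in> iso ?G (integer_mod_group 2 \<times>\<times> integer_mod_group 2)"
    by (simp add: iso_def bij_betw_def carrier_Z2)
  then show "?G \<cong> integer_mod_group 2 \<times>\<times> integer_mod_group 2"
    by (auto simp: is_iso_def)
qed

lemma isometries_a_to_h_group:
  shows "subgroup (isometries_of cases_a_to_h) (symmetry_group (dupin_cyclide_II a 0 f))"
    and "(symmetry_group (dupin_cyclide_II a 0 f)) \<lparr>carrier := isometries_of cases_a_to_h\<rparr>
      \<cong> integer_mod_group 2 \<times>\<times> integer_mod_group 2 \<times>\<times> integer_mod_group 2"
proof -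
  show "subgroup (isometries_of cases_a_to_h) (symmetry_group (dupin_cyclide_II a 0 f))"
  proof (rule subgroup_axis_reflections)
    show "isometries_of cases_a_to_h
        \<subseteq> {axis_reflection s1 s2 s3 | s1 s2 s3. s1 \<in> signs \<and> s2 \<in> signs \<and> s3 \<in> signs}"
      unfolding isometries_of_cases by blast
    show "F ` dupin_cyclide_II a 0 f = dupin_cyclide_II a 0 f" if "F \<in> isometries_of cases_a_to_h" for F
      using that unfolding isometries_of_cases UN_iff singleton_iff
      by (elim bexE) (simp add: axis_reflection_dupin_cyclide)
    show "F \<circ> G \<in> isometries_of cases_a_to_h"
      if "F \<in> isometries_of cases_a_to_h" "G \<in> isometries_of cases_a_to_h" for F G
      using that unfolding isometries_of_cases UN_iff singleton_iff
      by (elim bexE) (metis axis_reflection_comp sign_closed mult_1)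
    show "id \<in> isometries_of cases_a_to_h"
      using sign_closed(1) by (auto simp: isometries_of_cases simp flip: axis_reflection_id)
  qed
  let ?G = "(symmetry_group (dupin_cyclide_II a 0 f)) \<lparr>carrier := isometries_of cases_a_to_h\<rparr>"
  let ?h = "\<lambda>F. (sign_exponent (F 1 $ 1), sign_exponent (F 1 $ 2), sign_exponent (F 1 $ 3))"
  have "?h \<in> hom ?G (integer_mod_group 2 \<times>\<times> integer_mod_group 2 \<times>\<times> integer_mod_group 2)"
    by (rule homI)
      (auto simp: isometries_of_cases symmetry_group_def axis_reflection_comp axis_reflection_at_1
        sign_exponent_mult sign_exponent_in_Z2 simp del: o_apply)
  moreover have "inj_on ?h (isometries_of cases_a_to_h)"
    by (auto simp: inj_on_def isometries_of_cases axis_reflection_at_1 sign_exponent_def signs_def)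
  moreover have "?h ` isometries_of cases_a_to_h = {0, 1} \<times> {0, 1} \<times> {0, 1}"
    by (auto simp: isometries_of_cases axis_reflection_at_1 sign_exponent_def signs_def image_UN)
  ultimately have "?h \<in> iso ?G (integer_mod_group 2 \<times>\<times> integer_mod_group 2 \<times>\<times> integer_mod_group 2)"
    by (simp add: iso_def bij_betw_def carrier_Z2)
  then show "?G \<cong> integer_mod_group 2 \<times>\<times> integer_mod_group 2 \<times>\<times> integer_mod_group 2"
    by (auto simp: is_iso_def)
qed

theorem theorem13:
  fixes a b c f :: real
  assumes "a \<noteq> 0" and "b \<noteq> 0" and "f > 0" and "f\<^sup>2 = a\<^sup>2 - b\<^sup>2"
  shows
    "(\<forall>Q w \<phi>1 \<phi>2. orthogonal_matrix Q \<longrightarrow> moebius_transformation \<phi>1 \<longrightarrow> moebius_transformation \<phi>2 \<longrightarrow>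
        (condition_A1 a b f Q w \<phi>1 \<phi>2 \<and> condition_A2 a c f \<phi>1 \<phi>2 \<longleftrightarrow>
          c \<noteq> 0 \<and> (\<phi>1, \<phi>2, affine_map Q w) \<in> cases_a_to_d \<or>
          c = 0 \<and> (\<phi>1, \<phi>2, affine_map Q w) \<in> cases_a_to_h)) \<and>
     (c \<noteq> 0 \<longrightarrow>
        subgroup (isometries_of cases_a_to_d) (symmetry_group (dupin_cyclide_II a c f)) \<and>
        (symmetry_group (dupin_cyclide_II a c f)) \<lparr>carrier := isometries_of cases_a_to_d\<rparr>
          \<cong> integer_mod_group 2 \<times>\<times> integer_mod_group 2) \<and>
     (c = 0 \<longrightarrow>
        subgroup (isometries_of cases_a_to_h) (symmetry_group (dupin_cyclide_II a c f)) \<and>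
        (symmetry_group (dupin_cyclide_II a c f)) \<lparr>carrier := isometries_of cases_a_to_h\<rparr>
          \<cong> integer_mod_group 2 \<times>\<times> integer_mod_group 2 \<times>\<times> integer_mod_group 2)"
proof (intro conjI allI impI)
  fix Q :: "real ^ 3 ^ 3" and w \<phi>1 \<phi>2
  assume orth: "orthogonal_matrix Q"
    and moebius: "moebius_transformation \<phi>1" "moebius_transformation \<phi>2"
  have cases_iff:
    "c \<noteq> 0 \<and> (\<phi>1, \<phi>2, affine_map Q w) \<in> cases_a_to_d \<or>
     c = 0 \<and> (\<phi>1, \<phi>2, affine_map Q w) \<in> cases_a_to_h \<longleftrightarrow>
     (\<exists>s1\<in>signs. \<exists>s2\<in>signs. \<exists>s3\<in>signs. (c \<noteq> 0 \<longrightarrow> s1 = 1) \<and> \<phi>1 = signed_parameter s2 s1 \<and>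
       \<phi>2 = signed_parameter (s1 * s3) s1 \<and> affine_map Q w = axis_reflection s1 s2 s3)"
    using sign_closed(1) by (cases "c = 0") (auto simp: cases_a_to_d_eq cases_a_to_h_eq)
  show "condition_A1 a b f Q w \<phi>1 \<phi>2 \<and> condition_A2 a c f \<phi>1 \<phi>2 \<longleftrightarrow>
      c \<noteq> 0 \<and> (\<phi>1, \<phi>2, affine_map Q w) \<in> cases_a_to_d \<or>
      c = 0 \<and> (\<phi>1, \<phi>2, affine_map Q w) \<in> cases_a_to_h"
    unfolding cases_iff
  proof
    assume A: "condition_A1 a b f Q w \<phi>1 \<phi>2 \<and> condition_A2 a c f \<phi>1 \<phi>2"
    have "f \<noteq> 0"
      using assms(3) by simp
    from conditions_imp_signs[OF assms(1,2) this orth moebius_denominators_nonzero(1)[OF moebius(1)]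
        moebius_denominators_nonzero(2)[OF moebius(2)] conjunct1[OF A] conjunct2[OF A]]
    show "\<exists>s1\<in>signs. \<exists>s2\<in>signs. \<exists>s3\<in>signs. (c \<noteq> 0 \<longrightarrow> s1 = 1) \<and>
        \<phi>1 = signed_parameter s2 s1 \<and> \<phi>2 = signed_parameter (s1 * s3) s1 \<and>
        affine_map Q w = axis_reflection s1 s2 s3" .
  next
    assume "\<exists>s1\<in>signs. \<exists>s2\<in>signs. \<exists>s3\<in>signs. (c \<noteq> 0 \<longrightarrow> s1 = 1) \<and>
        \<phi>1 = signed_parameter s2 s1 \<and> \<phi>2 = signed_parameter (s1 * s3) s1 \<and>
        affine_map Q w = axis_reflection s1 s2 s3"
    then show "condition_A1 a b f Q w \<phi>1 \<phi>2 \<and> condition_A2 a c f \<phi>1 \<phi>2"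
      by (elim bexE conjE) (simp add: signs_imp_conditions)
  qed
qed (simp_all add: isometries_a_to_d_group isometries_a_to_h_group)

end
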